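(* For all nondegenerate Gaussian measures $\mu=\mathcal N(m_0,\Sigma_0)$ and $\nu=\mathcal N(m_1,\Sigma_1)$ on $\mathbb R^n$ (with $\Sigma_0,\Sigma_1\succ0$), $D_{\rm WKL}(\mu\,\|\,\nu)\ge0$, and $D_{\rm WKL}(\mu\,\|\,\nu)=0$ if and only if $\mu=\nu$.
   Context: Definition of $D_{\rm WKL}$. For $\mu=\mathcal N(m_0,\Sigma_0)$, $\nu=\mathcal N(m_1,\Sigma_1)$ with $\Sigma_0,\Sigma_1\succ0$, there is a unique quadratic function $f(x)=\frac12x^\top Ax+b^\top x$ with $A$ real symmetric and $b\in\mathbb R^n$ whose forward gradient flow $\frac{d}{dt}\varphi_t(x)=\nabla f(\varphi_t(x))=A\varphi_t(x)+b$, $\varphi_0(x)=x$, satisfies $(\varphi_1)_*\mu=\nu$ (push-forward of measures). Explicitly, $A=\log R$ (principal symmetric logarithm) with $R=\Sigma_0^{-1/2}(\Sigma_0^{1/2}\Sigma_1\Sigma_0^{1/2})^{1/2}\Sigma_0^{-1/2}$ (symmetric positive definite square roots), and $b=K_1(A)^{-1}(m_1-Rm_0)$ with $K_1(A)=\int_0^1e^{sA}\,ds$. The Wasserstein KL divergence is $$D_{\rm WKL}(\mu\,\|\,\nu):=\int_{\mathbb R^n}\int_0^1\bigl(f(\varphi_1(x))-f(\varphi_t(x))\bigr)\,dt\,d\mu(x).$$ *)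

theory Defs
  imports "HOL-Analysis.Analysis"
begin

definition pos_def :: "real^'n^'n \<Rightarrow> bool" where
  "pos_def S \<longleftrightarrow> transpose S = S \<and> (\<forall>x. x \<noteq> 0 \<longrightarrow> x \<bullet> (S *v x) > 0)"

text \<open>The intended domain is \<open>pos_def S\<close>.\<close>

definition gaussian :: "real^'n \<Rightarrow> real^'n^'n \<Rightarrow> (real^'n) measure" where
  "gaussian m S = density lborel (\<lambda>x. ennreal
     (exp (- ((x - m) \<bullet> (matrix_inv S *v (x - m))) / 2) / sqrt ((2 * pi) ^ CARD('n) * det S)))"

text \<open>Forward flow: it follows \<open>+\<nabla>f\<close>. The predicate \<open>GDERIV f y :> v\<close> says that \<open>v\<close> is the
  gradient of \<open>f\<close> at \<open>y\<close>.\<close>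

definition is_gradient_flow :: "(real^'n \<Rightarrow> real) \<Rightarrow> (real \<Rightarrow> real^'n \<Rightarrow> real^'n) \<Rightarrow> bool" where
  "is_gradient_flow f \<phi> \<longleftrightarrow> (\<forall>x. \<phi> 0 x = x \<and>
     (\<forall>t. \<exists>v. GDERIV f (\<phi> t x) :> v \<and> ((\<lambda>s. \<phi> s x) has_vector_derivative v) (at t)))"

definition gradient_flow :: "(real^'n \<Rightarrow> real) \<Rightarrow> real \<Rightarrow> real^'n \<Rightarrow> real^'n" where
  "gradient_flow f = (THE \<phi>. is_gradient_flow f \<phi>)"

definition is_quadratic :: "(real^'n \<Rightarrow> real) \<Rightarrow> bool" where
  "is_quadratic f \<longleftrightarrow> (\<exists>A b. transpose A = A \<and> f = (\<lambda>x. (x \<bullet> (A *v x)) / 2 + b \<bullet> x))"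

text \<open>The absence of a constant term in \<open>is_quadratic\<close> is what makes the potential itself, and not
  only its gradient, unique. For nondegenerate Gaussian \<open>\<mu>\<close>, \<open>\<nu>\<close> it is the one with \<open>A = log R\<close>
  and \<open>b = K\<^sub>1(A)\<inverse> (m\<^sub>1 - R m\<^sub>0)\<close>, where
  \<open>R = S\<^sub>0\<^bsup>-1/2\<^esup> (S\<^sub>0\<^bsup>1/2\<^esup> S\<^sub>1 S\<^sub>0\<^bsup>1/2\<^esup>)\<^bsup>1/2\<^esup> S\<^sub>0\<^bsup>-1/2\<^esup>\<close> and
  \<open>K\<^sub>1(A)\<close> is the integral of \<open>exp (s A)\<close> over \<open>s\<close> from 0 to 1.\<close>

definition wkl_potential :: "(real^'n) measure \<Rightarrow> (real^'n) measure \<Rightarrow> real^'n \<Rightarrow> real" where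
  "wkl_potential \<mu> \<nu> = (THE f. is_quadratic f \<and>
     (\<exists>\<phi>. is_gradient_flow f \<phi> \<and> \<phi> 1 \<in> borel_measurable \<mu> \<and> distr \<mu> borel (\<phi> 1) = \<nu>))"

definition wkl_divergence :: "(real^'n) measure \<Rightarrow> (real^'n) measure \<Rightarrow> real" where
  "wkl_divergence \<mu> \<nu> =
     (let f = wkl_potential \<mu> \<nu>; \<phi> = gradient_flow f
      in LINT x|\<mu>. (LINT t:{0..1}|lborel. f (\<phi> 1 x) - f (\<phi> t x)))"

end

theory Submission
  imports Defs "HOL-Probability.Distributions"
begin

text \<open>
  Along the gradient flow of a potential \<open>f\<close> the value of \<open>f\<close> can only grow, at the rate
  \<open>\<bar>\<nabla>f\<bar>\<^sup>2\<close>; this makes the divergence nonnegative, and it can vanish only if \<open>\<nabla>f = 0\<close> almost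
  everywhere, in which case the flow does not move anything and \<open>\<mu> = \<nu>\<close>.  Conversely, for
  \<open>\<mu> = \<nu>\<close> the zero potential does the transport.  Since potential and flow are given by definite
  descriptions, this argument rests on existence and uniqueness of both.

  Everything is computed in an orthonormal eigenbasis \<open>B\<close> of the symmetric matrix \<open>A\<close>, with
  eigenvalues \<open>l v\<close>, which the spectral theorem provides.  There the flow of
  \<open>f x = (x \<bullet> A x) / 2 + b \<bullet> x\<close> decouples into scalar linear equations with the explicit solution
  \<open>affine_flow\<close>, and its time-one map is \<open>x \<mapsto> R x + K b\<close> with \<open>R = exp A\<close> and \<open>K\<close> the integral of
  \<open>exp (s A)\<close> over the unit interval, both positive definite.  It carries \<open>N(m\<^sub>0, S\<^sub>0)\<close> to
  \<open>N(R m\<^sub>0 + K b, R S\<^sub>0 R)\<close> (\<open>distr_gaussian_affine\<close>), and a nondegenerate Gaussian determines its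
  parameters (\<open>gaussian_inj\<close>).  So a transporting potential amounts to a positive definite solution
  \<open>R\<close> of \<open>R S\<^sub>0 R = S\<^sub>1\<close>, its logarithm \<open>A\<close>, and the vector \<open>b\<close> solving \<open>K b = m\<^sub>1 - R m\<^sub>0\<close>.  Each of
  the three exists and is unique (\<open>riccati_exists\<close>, \<open>riccati_unique\<close>, \<open>spectral_transfer\<close>).

  In the eigenbasis the inner time integral becomes
  \<open>(\<Sum>v\<in>B. w v * (l v * (v \<bullet> x) + v \<bullet> b)\<^sup>2)\<close> with strictly positive weights
  (\<open>potential_gain_along_flow\<close>, \<open>flow_weight_pos\<close>).  The squared terms are the squared coordinates of
  \<open>\<nabla>f x\<close>.  Since the Bochner integral of a function that is not integrable is zero, the vanishing
  of the divergence is informative only because these squares are integrable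
  (\<open>integrable_gaussian_affine_square\<close>).
\<close>

section \<open>Orthonormal eigenbases and the functional calculus\<close>

lemma symmetric_inner_swap:
  fixes A :: "real^'n^'n"
  assumes "transpose A = A"
  shows "x \<bullet> (A *v y) = (A *v x) \<bullet> y"
  by (metis assms dot_lmul_matrix vector_transpose_matrix)

text \<open>Variational: a maximiser of \<open>x \<bullet> A x\<close> on the unit sphere of \<open>V\<close> is an eigenvector, because
  the residual \<open>w = l v - A v\<close> lies in \<open>V\<close> and a nonzero residual would make the form
  \<open>l (x \<bullet> x) - x \<bullet> A x\<close>, which is nonnegative on \<open>V\<close>, negative at some \<open>v + t w\<close>.\<close>

lemma symmetric_invariant_subspace_eigenvector:
  fixes A :: "real^'n^'n"
  assumes sym: "transpose A = A" and V: "subspace V" "z \<in> V" "z \<noteq> 0"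
    and inv: "\<And>x. x \<in> V \<Longrightarrow> A *v x \<in> V"
  obtains v l where "v \<in> V" "norm v = 1" "A *v v = l *\<^sub>R v"
proof -
  let ?K = "V \<inter> sphere 0 1"
  have "compact ?K" using V(1) by (simp add: closed_Int_compact closed_subspace)
  moreover have "(1 / norm z) *\<^sub>R z \<in> ?K" using V by (auto simp: subspace_scale)
  moreover have "continuous_on ?K (\<lambda>x. x \<bullet> (A *v x))"
    by (intro continuous_intros linear_continuous_on matrix_vector_mul_bounded_linear)
  ultimately obtain v where v: "v \<in> ?K" and max: "\<And>y. y \<in> ?K \<Longrightarrow> y \<bullet> (A *v y) \<le> v \<bullet> (A *v v)"
    using continuous_attains_sup[of ?K "\<lambda>x. x \<bullet> (A *v x)"] by blast
  define l where "l = v \<bullet> (A *v v)"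
  have vv: "v \<bullet> v = 1" using v by (simp add: norm_eq_1)
  have Q: "0 \<le> l * (y \<bullet> y) - y \<bullet> (A *v y)" if "y \<in> V" for y
  proof (cases "y = 0")
    case False
    then have "(1 / norm y) *\<^sub>R y \<in> ?K" using that V by (auto simp: subspace_scale)
    from max[OF this] have "y \<bullet> (A *v y) / (norm y)\<^sup>2 \<le> l"
      by (simp add: l_def matrix_vector_mult_scaleR power2_eq_square)
    then show ?thesis using False by (simp add: divide_simps dot_square_norm)
  qed simp
  define w where "w = l *\<^sub>R v - A *v v"
  have wV: "w \<in> V" using v V inv by (auto simp: w_def intro!: subspace_diff subspace_scale)
  define q where "q = l * (w \<bullet> w) - w \<bullet> (A *v w)"
  have q: "q \<ge> 0" using Q[OF wV] by (simp add: q_def)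
  have quad: "0 \<le> 2 * t * (w \<bullet> w) + t\<^sup>2 * q" for t
  proof -
    have "v + t *\<^sub>R w \<in> V" using v wV V by (auto intro!: subspace_add subspace_scale)
    from Q[OF this] have "0 \<le> l * ((v + t *\<^sub>R w) \<bullet> (v + t *\<^sub>R w)) - (v + t *\<^sub>R w) \<bullet> (A *v (v + t *\<^sub>R w))" .
    also have "\<dots> = 2 * t * (w \<bullet> (l *\<^sub>R v - A *v v)) + t\<^sup>2 * q"
      using symmetric_inner_swap[OF sym, of v w]
      by (simp add: q_def matrix_vector_right_distrib matrix_vector_mult_scaleR inner_add_left
          inner_add_right inner_diff_right vv l_def[symmetric] algebra_simps power2_eq_square
          inner_commute)
    finally show ?thesis by (simp add: w_def)
  qed
  have "w \<bullet> w = 0"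
  proof (rule ccontr)
    assume "w \<bullet> w \<noteq> 0"
    then have p: "w \<bullet> w > 0" by simp
    \<comment> \<open>The quadratic in \<open>t\<close> is smallest at \<open>t = - (w \<bullet> w) / q\<close>; the shift to \<open>q + 1\<close> covers \<open>q = 0\<close>.\<close>
    have "2 * (- (w \<bullet> w) / (q + 1)) * (w \<bullet> w) + (- (w \<bullet> w) / (q + 1))\<^sup>2 * q
      = - ((w \<bullet> w)\<^sup>2 * (q + 2) / (q + 1)\<^sup>2)"
      using q by (simp add: divide_simps power2_eq_square) (simp add: algebra_simps)
    moreover have "(w \<bullet> w)\<^sup>2 * (q + 2) / (q + 1)\<^sup>2 > 0" using p q by simp
    ultimately show False using quad[of "- (w \<bullet> w) / (q + 1)"] by linarith
  qed
  then have "A *v v = l *\<^sub>R v" by (simp add: w_def)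
  then show thesis using that v by auto
qed

definition orthonormal_basis :: "(real^'n) set \<Rightarrow> bool" where
  "orthonormal_basis B \<longleftrightarrow> pairwise orthogonal B \<and> (\<forall>v\<in>B. norm v = 1) \<and> span B = UNIV"

text \<open>The functional calculus: for \<open>A = spectral B l\<close>, the matrix \<open>h(A)\<close> is
  \<open>spectral B (\<lambda>v. h (l v))\<close>.  Square roots, inverses and exponentials all take this form.\<close>

definition spectral :: "(real^'n) set \<Rightarrow> (real^'n \<Rightarrow> real) \<Rightarrow> real^'n^'n" where
  "spectral B g = matrix (\<lambda>x. \<Sum>v\<in>B. (g v * (v \<bullet> x)) *\<^sub>R v)"

lemma orthonormal_set_independent:
  assumes "pairwise orthogonal B" "\<And>v. v \<in> B \<Longrightarrow> norm v = 1"
  shows "independent (B :: (real^'n) set)"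
  using assms pairwise_orthogonal_independent by fastforce

lemma orthonormal_basis_finite: "orthonormal_basis B \<Longrightarrow> finite B"
  by (simp add: orthonormal_basis_def orthonormal_set_independent independent_imp_finite)

lemma orthonormal_basis_inner:
  assumes "orthonormal_basis B" "v \<in> B" "w \<in> B"
  shows "v \<bullet> w = (if v = w then 1 else 0)"
  using assms by (auto simp: orthonormal_basis_def pairwise_def orthogonal_def norm_eq_1)

lemma orthonormal_basis_inner_sum:
  assumes B: "orthonormal_basis B" and "w \<in> B"
  shows "w \<bullet> (\<Sum>v\<in>B. c v *\<^sub>R v) = c w"
proof -
  have "w \<bullet> (\<Sum>v\<in>B. c v *\<^sub>R v) = (\<Sum>v\<in>B. if v = w then c v else 0)"
    unfolding inner_sum_right
    by (rule sum.cong) (auto simp: orthonormal_basis_inner[OF B \<open>w \<in> B\<close>])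
  then show ?thesis using assms by (simp add: orthonormal_basis_finite)
qed

lemma orthonormal_basis_expansion:
  assumes "orthonormal_basis B"
  shows "(\<Sum>v\<in>B. (v \<bullet> x) *\<^sub>R v) = x"
  using orthonormal_basis_expand[of B x] orthonormal_basis_finite[OF assms] assms
  by (simp add: orthonormal_basis_def inner_commute)

lemma orthonormal_basis_eqI:
  assumes "orthonormal_basis B" "\<And>v. v \<in> B \<Longrightarrow> v \<bullet> x = v \<bullet> y"
  shows "x = y"
proof -
  have "x = (\<Sum>v\<in>B. (v \<bullet> x) *\<^sub>R v)"
    by (rule orthonormal_basis_expansion[OF assms(1), symmetric])
  also have "\<dots> = (\<Sum>v\<in>B. (v \<bullet> y) *\<^sub>R v)" using assms by (intro sum.cong) auto
  also have "\<dots> = y" using assms by (simp add: orthonormal_basis_expansion)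
  finally show ?thesis .
qed

lemma orthonormal_basis_parseval:
  assumes "orthonormal_basis B"
  shows "x \<bullet> y = (\<Sum>v\<in>B. (v \<bullet> x) * (v \<bullet> y))"
  by (subst (1) orthonormal_basis_expansion[OF assms, of x, symmetric])
     (simp add: inner_sum_left)

lemma spectral_mult_vector: "spectral B g *v x = (\<Sum>v\<in>B. (g v * (v \<bullet> x)) *\<^sub>R v)"
proof -
  have "linear (\<lambda>x. \<Sum>v\<in>B. (g v * (v \<bullet> x)) *\<^sub>R v)"
    by (intro linear_compose_sum ballI linearI)
       (auto simp: inner_add_right algebra_simps)
  then show ?thesis unfolding spectral_def by (simp add: matrix_vector_mul(2)[symmetric])
qed

lemma spectral_coord:
  assumes "orthonormal_basis B" "w \<in> B"
  shows "w \<bullet> (spectral B g *v x) = g w * (w \<bullet> x)"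
  using orthonormal_basis_inner_sum[OF assms] by (simp add: spectral_mult_vector)

lemma spectral_eigenvector:
  assumes "orthonormal_basis B" "w \<in> B"
  shows "spectral B g *v w = g w *\<^sub>R w"
  using assms by (intro orthonormal_basis_eqI[OF assms(1)])
    (auto simp: spectral_coord orthonormal_basis_inner)

lemma spectral_cong: "(\<And>v. v \<in> B \<Longrightarrow> g v = h v) \<Longrightarrow> spectral B g = spectral B h"
  unfolding spectral_def by (metis (no_types, lifting) sum.cong)

lemma spectral_eqI:
  assumes "orthonormal_basis B" "\<And>v. v \<in> B \<Longrightarrow> A *v v = g v *\<^sub>R v"
  shows "A = spectral B g"
proof -
  have "A *v x = spectral B g *v x" for x
  proof -
    have "A *v x = A *v (\<Sum>v\<in>B. (v \<bullet> x) *\<^sub>R v)"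
      by (simp add: orthonormal_basis_expansion assms)
    also have "\<dots> = (\<Sum>v\<in>B. (v \<bullet> x) *\<^sub>R (A *v v))"
      by (simp add: linear_sum[OF matrix_vector_mul_linear] matrix_vector_mult_scaleR)
    also have "\<dots> = spectral B g *v x"
      unfolding spectral_mult_vector by (rule sum.cong) (auto simp: assms)
    finally show ?thesis .
  qed
  then show ?thesis by (simp add: matrix_eq)
qed

lemma spectral_one: "orthonormal_basis B \<Longrightarrow> spectral B (\<lambda>_. 1) = mat 1"
  using spectral_eqI[of B "mat 1" "\<lambda>_. 1"] by simp

lemma spectral_mult:
  assumes "orthonormal_basis B"
  shows "spectral B g ** spectral B h = spectral B (\<lambda>v. g v * h v)"
  using assms
  by (intro spectral_eqI)
     (auto simp: matrix_vector_mul_assoc[symmetric] spectral_eigenvector matrix_vector_mult_scaleR)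

lemma spectral_inner:
  assumes "orthonormal_basis B"
  shows "x \<bullet> (spectral B g *v y) = (\<Sum>v\<in>B. g v * (v \<bullet> x) * (v \<bullet> y))"
  by (subst orthonormal_basis_parseval[OF assms], rule sum.cong)
     (auto simp: spectral_coord[OF assms])

lemma symmetricI:
  fixes A :: "real^'n^'n"
  assumes "\<And>x y. x \<bullet> (A *v y) = (A *v x) \<bullet> y"
  shows "transpose A = A"
proof -
  have "transpose A *v x = A *v x" for x
    by (rule vector_eq_rdot[THEN iffD1], rule allI)
       (metis assms dot_lmul_matrix vector_transpose_matrix transpose_transpose inner_commute)
  then show ?thesis by (simp add: matrix_eq)
qed

lemma spectral_symmetric:
  assumes "orthonormal_basis B"
  shows "transpose (spectral B g) = spectral B g"
  by (rule symmetricI)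
     (simp add: spectral_inner[OF assms] inner_commute[of "spectral B g *v _"] mult_ac)

text \<open>A largest orthonormal set of eigenvectors spans: its orthogonal complement is invariant under
  the symmetric \<open>A\<close> and would otherwise contribute a further eigenvector.\<close>

theorem spectral_theorem:
  fixes A :: "real^'n^'n"
  assumes sym: "transpose A = A"
  obtains B g where "orthonormal_basis B" "A = spectral B g"
proof -
  define P where "P B \<longleftrightarrow> pairwise orthogonal B \<and> (\<forall>v\<in>B. norm v = 1 \<and> (\<exists>l. A *v v = l *\<^sub>R v))"
    for B :: "(real^'n) set"
  have bound: "finite B \<and> card B < Suc (DIM(real^'n))" if "P B" for B
    using that orthonormal_set_independent[of B] independent_bound[of B] by (auto simp: P_def)
  have "P {}" by (simp add: P_def)
  then have "\<exists>B. P B \<and> (\<forall>C. P C \<longrightarrow> card C \<le> card B)"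
    using bound by (intro ex_has_greatest_nat[of P "{}" card "Suc (DIM(real^'n))"]) auto
  then obtain B where B: "P B" and max: "\<And>C. P C \<Longrightarrow> card C \<le> card B" by blast
  have "span B = UNIV"
  proof (rule ccontr)
    assume "span B \<noteq> UNIV"
    then have "span B \<subset> span UNIV" by auto
    then obtain z where z: "z \<noteq> 0" "\<And>x. x \<in> span B \<Longrightarrow> orthogonal z x"
      by (rule orthogonal_to_subspace_exists_gen) blast
    let ?V = "{x. \<forall>v\<in>B. v \<bullet> x = 0}"
    have "subspace ?V" by (auto simp: subspace_def inner_add_right)
    moreover have "z \<in> ?V" using z(2) by (auto simp: orthogonal_def inner_commute span_base)
    moreover have "A *v x \<in> ?V" if "x \<in> ?V" for x
    proof (intro CollectI ballI)
      fix v assume v: "v \<in> B"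
      then obtain l where "A *v v = l *\<^sub>R v" using B by (auto simp: P_def)
      then show "v \<bullet> (A *v x) = 0" using v that by (simp add: symmetric_inner_swap[OF sym])
    qed
    ultimately obtain v l where v: "v \<in> ?V" "norm v = 1" "A *v v = l *\<^sub>R v"
      by (rule symmetric_invariant_subspace_eigenvector[OF sym _ _ z(1), of ?V])
    have "v \<notin> B" using v by (auto simp: norm_eq_1)
    moreover have "P (insert v B)"
      using B v unfolding P_def by (auto simp: pairwise_insert orthogonal_def inner_commute)
    ultimately show False using max[of "insert v B"] bound[OF B] by simp
  qed
  then have onb: "orthonormal_basis B" using B by (auto simp: P_def orthonormal_basis_def)
  obtain g where "\<And>v. v \<in> B \<Longrightarrow> A *v v = g v *\<^sub>R v"
    using B unfolding P_def by metis
  then show thesis using that spectral_eqI[OF onb] onb by blast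
qed

text \<open>Two spectral representations of one matrix have the same eigenspaces, since \<open>v\<close> and \<open>w\<close> are
  orthogonal unless their eigenvalues agree.  Reading this with \<open>a\<close> an injective function of \<open>a'\<close> shows
  that square roots and logarithms are unique; with \<open>a'\<close> a function of \<open>a\<close>, that the functional
  calculus does not depend on the eigenbasis.\<close>

lemma spectral_transfer:
  fixes B C :: "(real^'n) set"
  assumes B: "orthonormal_basis B" and C: "orthonormal_basis C"
    and eq: "spectral B a = spectral C c"
    and imp: "\<And>v w. v \<in> B \<Longrightarrow> w \<in> C \<Longrightarrow> a v = c w \<Longrightarrow> a' v = c' w"
  shows "spectral B a' = spectral C c'"
proof (rule spectral_eqI[OF C], rule orthonormal_basis_eqI[OF B])
  fix w v assume w: "w \<in> C" and v: "v \<in> B"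
  have "a v * (v \<bullet> w) = c w * (v \<bullet> w)"
    using spectral_coord[OF B v, of a w] spectral_eigenvector[OF C w, of c] eq
    by (metis inner_scaleR_right)
  then show "v \<bullet> (spectral B a' *v w) = v \<bullet> (c' w *\<^sub>R w)"
    using imp[OF v w] by (auto simp: spectral_coord[OF B v])
qed

section \<open>Positive definite matrices\<close>

lemma pos_def_symmetric: "pos_def S \<Longrightarrow> transpose S = S"
  by (simp add: pos_def_def)

lemma pos_def_spectral_iff:
  assumes "orthonormal_basis B"
  shows "pos_def (spectral B g) \<longleftrightarrow> (\<forall>v\<in>B. g v > 0)"
proof
  assume pd: "pos_def (spectral B g)"
  show "\<forall>v\<in>B. g v > 0"
  proof
    fix v assume v: "v \<in> B"
    then have vv: "v \<bullet> v = 1" using orthonormal_basis_inner[OF assms] by simp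
    then have "v \<noteq> 0" by auto
    then have "v \<bullet> (spectral B g *v v) > 0" using pd by (simp add: pos_def_def)
    then show "g v > 0" using spectral_coord[OF assms v] vv by simp
  qed
next
  assume g: "\<forall>v\<in>B. g v > 0"
  have "x \<bullet> (spectral B g *v x) > 0" if "x \<noteq> 0" for x
  proof -
    have "\<exists>v\<in>B. v \<bullet> x \<noteq> 0"
      using orthonormal_basis_eqI[OF assms, of x 0] that by auto
    then obtain v where "v \<in> B" "v \<bullet> x \<noteq> 0" ..
    then show ?thesis unfolding spectral_inner[OF assms]
      using g orthonormal_basis_finite[OF assms]
      by (intro sum_pos2[of B v]) (auto simp: mult.assoc zero_less_mult_iff less_imp_le)
  qed
  then show "pos_def (spectral B g)" by (simp add: pos_def_def spectral_symmetric[OF assms])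
qed

lemma pos_def_congruence:
  assumes "pos_def S" "transpose P = P" "\<And>x. P *v x = 0 \<Longrightarrow> x = 0"
  shows "pos_def (P ** S ** P)"
  using assms unfolding pos_def_def
  by (auto simp: matrix_transpose_mul matrix_mul_assoc matrix_vector_mul_assoc[symmetric]
      symmetric_inner_swap[of P])

lemma pos_def_kernel: "pos_def S \<Longrightarrow> S *v x = 0 \<Longrightarrow> x = 0"
  unfolding pos_def_def by force

lemma matrix_inv_eqI:
  fixes A :: "real^'n^'n"
  assumes "A ** Q = mat 1" "Q ** A = mat 1"
  shows "matrix_inv A = Q"
proof -
  have "A ** matrix_inv A = mat 1 \<and> matrix_inv A ** A = mat 1"
    unfolding matrix_inv_def by (rule someI[of _ Q]) (use assms in auto)
  then show ?thesis using assms by (metis matrix_mul_assoc matrix_mul_lid matrix_mul_rid)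
qed

lemma pos_def_matrix_inv:
  fixes S :: "real^'n^'n"
  assumes "pos_def S"
  shows "S ** matrix_inv S = mat 1" "matrix_inv S ** S = mat 1" "pos_def (matrix_inv S)"
proof -
  obtain B g where B: "orthonormal_basis B" and S: "S = spectral B g"
    using spectral_theorem pos_def_symmetric[OF assms] by metis
  have g: "\<forall>v\<in>B. g v > 0" using assms pos_def_spectral_iff[OF B] S by simp
  let ?T = "spectral B (\<lambda>v. inverse (g v))"
  have "S ** ?T = spectral B (\<lambda>_. 1)" "?T ** S = spectral B (\<lambda>_. 1)"
    unfolding S spectral_mult[OF B] using g by (auto intro!: spectral_cong simp: less_imp_neq[THEN not_sym])
  then have T: "S ** ?T = mat 1" "?T ** S = mat 1" using spectral_one[OF B] by auto
  then have inv: "matrix_inv S = ?T" by (rule matrix_inv_eqI)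
  then show "S ** matrix_inv S = mat 1" "matrix_inv S ** S = mat 1" using T by simp_all
  show "pos_def (matrix_inv S)" unfolding inv using g by (simp add: pos_def_spectral_iff[OF B])
qed

lemma pos_def_sqrt:
  fixes S :: "real^'n^'n"
  assumes "pos_def S"
  obtains P where "pos_def P" "P ** P = S"
proof -
  obtain B g where B: "orthonormal_basis B" and S: "S = spectral B g"
    using spectral_theorem pos_def_symmetric[OF assms] by metis
  have g: "\<forall>v\<in>B. g v > 0" using assms pos_def_spectral_iff[OF B] S by simp
  show thesis
  proof
    show "pos_def (spectral B (\<lambda>v. sqrt (g v)))" using g by (simp add: pos_def_spectral_iff[OF B])
    show "spectral B (\<lambda>v. sqrt (g v)) ** spectral B (\<lambda>v. sqrt (g v)) = S"
      unfolding S spectral_mult[OF B] using g by (intro spectral_cong) (auto simp: less_imp_le)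
  qed
qed

lemma pos_def_sqrt_unique:
  fixes P Q :: "real^'n^'n"
  assumes "pos_def P" "pos_def Q" "P ** P = Q ** Q"
  shows "P = Q"
proof -
  obtain B g where B: "orthonormal_basis B" and P: "P = spectral B g"
    using spectral_theorem pos_def_symmetric[OF assms(1)] by metis
  obtain C h where C: "orthonormal_basis C" and Q: "Q = spectral C h"
    using spectral_theorem pos_def_symmetric[OF assms(2)] by metis
  have g: "\<forall>v\<in>B. g v > 0" "\<forall>v\<in>C. h v > 0"
    using assms pos_def_spectral_iff B C P Q by auto
  have "spectral B (\<lambda>v. (g v)\<^sup>2) = spectral C (\<lambda>v. (h v)\<^sup>2)"
    using assms(3) unfolding P Q spectral_mult[OF B] spectral_mult[OF C] by (simp add: power2_eq_square)
  then show ?thesis unfolding P Q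
    by (rule spectral_transfer[OF B C]) (use g in \<open>force simp: power2_eq_iff_nonneg less_imp_le\<close>)
qed

lemma pos_def_det_pos:
  fixes S :: "real^'n^'n"
  assumes "pos_def S"
  shows "det S > 0"
proof -
  obtain P where P: "pos_def P" "P ** P = S" using pos_def_sqrt[OF assms] .
  have "det P * det (matrix_inv P) = 1"
    using pos_def_matrix_inv(1)[OF P(1)] by (metis det_I det_mul)
  then have "det P \<noteq> 0" by auto
  moreover have "det S = det P * det P" using P(2) by (metis det_mul)
  ultimately show ?thesis by (metis not_real_square_gt_zero)
qed

lemma pos_def_coercive:
  fixes S :: "real^'n^'n"
  assumes "pos_def S"
  obtains k where "k > 0" "\<And>x. k * (norm x)\<^sup>2 \<le> x \<bullet> (S *v x)"
proof -
  obtain B g where B: "orthonormal_basis B" and S: "S = spectral B g"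
    using spectral_theorem pos_def_symmetric[OF assms] by metis
  have g: "\<forall>v\<in>B. g v > 0" using assms pos_def_spectral_iff[OF B] S by simp
  note fin = orthonormal_basis_finite[OF B]
  define k where "k = Min (insert 1 (g ` B))"
  have "k > 0" using g fin by (simp add: k_def)
  moreover have "k * (norm x)\<^sup>2 \<le> x \<bullet> (S *v x)" for x
  proof -
    have "k * (norm x)\<^sup>2 = (\<Sum>v\<in>B. k * ((v \<bullet> x) * (v \<bullet> x)))"
      by (simp add: power2_norm_eq_inner orthonormal_basis_parseval[OF B, of x x] sum_distrib_left)
    also have "\<dots> \<le> (\<Sum>v\<in>B. g v * ((v \<bullet> x) * (v \<bullet> x)))"
      using fin by (intro sum_mono mult_right_mono) (auto simp: k_def)
    finally show ?thesis by (simp add: S spectral_inner[OF B] mult.assoc)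
  qed
  ultimately show thesis by (rule that)
qed

text \<open>With \<open>P\<close> the square root of \<open>S\<close>, the square of \<open>P R P\<close> is \<open>P (R S R) P\<close>, so \<open>P R P\<close> is
  determined as a positive definite square root.\<close>

lemma riccati_unique:
  fixes R Q S :: "real^'n^'n"
  assumes "pos_def S" "pos_def R" "pos_def Q" "R ** S ** R = Q ** S ** Q"
  shows "R = Q"
proof -
  obtain P where P: "pos_def P" "P ** P = S" using pos_def_sqrt[OF assms(1)] .
  have pd: "pos_def (P ** R ** P)" "pos_def (P ** Q ** P)"
    using assms P pos_def_congruence pos_def_symmetric pos_def_kernel by blast+
  have "(P ** X ** P) ** (P ** X ** P) = P ** (X ** S ** X) ** P" for X
    by (simp add: P(2)[symmetric] matrix_mul_assoc)
  then have "P ** R ** P = P ** Q ** P"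
    using pos_def_sqrt_unique[OF pd] assms(4) by metis
  then have "matrix_inv P ** (P ** R ** P) ** matrix_inv P = matrix_inv P ** (P ** Q ** P) ** matrix_inv P"
    by simp
  then show ?thesis using pos_def_matrix_inv[OF P(1)]
    by (metis matrix_mul_assoc matrix_mul_lid matrix_mul_rid)
qed

text \<open>The solution is \<open>R = P\<^bsup>-1\<^esup> (P T P)\<^bsup>1/2\<^esup> P\<^bsup>-1\<^esup>\<close> with \<open>P = S\<^bsup>1/2\<^esup>\<close>, the linear part of the
  optimal transport map between centred Gaussians.\<close>

lemma riccati_exists:
  fixes S T :: "real^'n^'n"
  assumes "pos_def S" "pos_def T"
  obtains R where "pos_def R" "R ** S ** R = T"
proof -
  obtain P where P: "pos_def P" "P ** P = S" using pos_def_sqrt[OF assms(1)] .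
  have "pos_def (P ** T ** P)"
    using assms P pos_def_congruence pos_def_symmetric pos_def_kernel by blast
  then obtain N where N: "pos_def N" "N ** N = P ** T ** P" using pos_def_sqrt by metis
  note inv = pos_def_matrix_inv[OF P(1)]
  let ?I = "matrix_inv P"
  have I: "X ** ?I ** P = X" "X ** P ** ?I = X" for X :: "real^'n^'n"
    by (metis inv matrix_mul_assoc matrix_mul_rid)+
  show thesis
  proof
    show "pos_def (?I ** N ** ?I)"
      using inv N pos_def_congruence pos_def_symmetric pos_def_kernel by blast
    have "?I ** N ** ?I ** S ** (?I ** N ** ?I) = ?I ** (N ** N) ** ?I"
      by (simp add: P(2)[symmetric] matrix_mul_assoc I)
    also have "\<dots> = T"
      unfolding N(2) by (simp add: matrix_mul_assoc I inv)
    finally show "?I ** N ** ?I ** S ** (?I ** N ** ?I) = T" .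
  qed
qed

section \<open>Gaussian densities\<close>

definition gaussian_pdf :: "real^'n \<Rightarrow> real^'n^'n \<Rightarrow> real^'n \<Rightarrow> real" where
  "gaussian_pdf m S x =
     exp (- ((x - m) \<bullet> (matrix_inv S *v (x - m))) / 2) / sqrt ((2 * pi) ^ CARD('n) * det S)"

lemma gaussian_eq_density: "gaussian m S = density lborel (\<lambda>x. ennreal (gaussian_pdf m S x))"
  by (simp add: gaussian_def gaussian_pdf_def)

lemma sets_gaussian [simp, measurable_cong]: "sets (gaussian m S) = sets borel"
  by (simp add: gaussian_def)

lemma space_gaussian [simp]: "space (gaussian m S) = UNIV"
  by (simp add: gaussian_def)

lemma continuous_gaussian_pdf: "continuous_on UNIV (gaussian_pdf m (S :: real^'n^'n))"
proof -
  have "continuous_on UNIV (\<lambda>x. matrix_inv S *v (x - m))"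
    by (intro continuous_on_compose2[OF linear_continuous_on[OF matrix_vector_mul_bounded_linear]]
        continuous_intros) auto
  then show ?thesis unfolding gaussian_pdf_def divide_inverse by (intro continuous_intros)
qed

lemma measurable_gaussian_pdf [measurable]: "gaussian_pdf m S \<in> borel_measurable borel"
  by (rule borel_measurable_continuous_onI[OF continuous_gaussian_pdf])

lemma gaussian_pdf_pos:
  fixes S :: "real^'n^'n"
  assumes "pos_def S"
  shows "gaussian_pdf m S x > 0"
  using pos_def_det_pos[OF assms] by (simp add: gaussian_pdf_def)

text \<open>The set where two continuous functions differ is open, and a nonempty open set is not null.\<close>

lemma continuous_AE_lborel_eq:
  fixes f g :: "'a::euclidean_space \<Rightarrow> 'b::t2_space"
  assumes "continuous_on UNIV f" "continuous_on UNIV g" "AE x in lborel. f x = g x"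
  shows "f = g"
proof -
  let ?N = "{x. f x \<noteq> g x}"
  have "open ?N" using assms(1,2) by (rule open_Collect_neq)
  have "?N \<in> null_sets lborel"
    using assms(3) \<open>open ?N\<close> by (subst (asm) AE_iff_null) auto
  then have "negligible ?N" by (simp add: negligible_iff_null_sets null_sets_completionI)
  then have "?N = {}" using \<open>open ?N\<close> open_not_negligible by blast
  then show ?thesis by auto
qed

lemma gaussian_inj:
  fixes S T :: "real^'n^'n"
  assumes S: "pos_def S" and T: "pos_def T" and eq: "gaussian m S = gaussian p T"
  shows "m = p" "S = T"
proof -
  define Z where "Z X = sqrt ((2 * pi) ^ CARD('n) * det X)" for X :: "real^'n^'n"
  have Z: "Z S > 0" "Z T > 0" using S T by (simp_all add: Z_def pos_def_det_pos)
  have "AE x in lborel. ennreal (gaussian_pdf m S x) = ennreal (gaussian_pdf p T x)"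
    using eq unfolding gaussian_eq_density by (subst (asm) sigma_finite_measure.density_unique_iff[OF sigma_finite_lborel]) auto
  then have "AE x in lborel. gaussian_pdf m S x = gaussian_pdf p T x"
    using gaussian_pdf_pos[OF S] gaussian_pdf_pos[OF T] by (simp add: less_imp_le ennreal_inj)
  then have pdf: "gaussian_pdf m S = gaussian_pdf p T"
    by (rule continuous_AE_lborel_eq[OF continuous_gaussian_pdf continuous_gaussian_pdf])
  define q where "q X z = z \<bullet> (matrix_inv X *v z)" for X :: "real^'n^'n" and z
  have pt: "exp (- q S (x - m) / 2) / Z S = exp (- q T (x - p) / 2) / Z T" for x
    using fun_cong[OF pdf, of x] by (simp add: gaussian_pdf_def q_def Z_def)
  have q0: "q X 0 = 0" for X by (simp add: q_def)
  have qpos: "z \<noteq> 0 \<Longrightarrow> q S z > 0" "z \<noteq> 0 \<Longrightarrow> q T z > 0" for z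
    using pos_def_matrix_inv(3) S T by (auto simp: q_def pos_def_def)
  \<comment> \<open>Each density attains its maximum \<open>1 / Z\<close> exactly at its mean; distinct means would make each
    maximum smaller than the other.\<close>
  show mp: "m = p"
  proof (rule ccontr)
    assume ne: "m \<noteq> p"
    have "1 / Z S = exp (- q T (m - p) / 2) / Z T" using pt[of m] by (simp add: q0)
    also have "\<dots> < 1 / Z T" using qpos(2)[of "m - p"] ne Z by (intro divide_strict_right_mono) auto
    finally have 1: "1 / Z S < 1 / Z T" .
    have "1 / Z T = exp (- q S (p - m) / 2) / Z S" using pt[of p] by (simp add: q0)
    also have "\<dots> < 1 / Z S" using qpos(1)[of "p - m"] ne Z by (intro divide_strict_right_mono) auto
    finally show False using 1 by simp
  qed
  have ZZ: "Z S = Z T" using pt[of m] Z by (simp add: mp q0)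
  have qq: "q S z = q T z" for z using pt[of "z + m"] Z by (simp add: mp ZZ)
  let ?D = "matrix_inv S - matrix_inv T"
  have Dsym: "transpose ?D = ?D"
    using pos_def_matrix_inv(3)[OF S] pos_def_matrix_inv(3)[OF T]
    by (simp add: pos_def_def transpose_def vec_eq_iff)
  have D0: "z \<bullet> (?D *v z) = 0" for z
    using qq[of z] by (simp add: q_def matrix_vector_mult_diff_rdistrib inner_diff_right)
  obtain B g where B: "orthonormal_basis B" and D: "?D = spectral B g"
    using spectral_theorem[OF Dsym] .
  have "g v = 0" if "v \<in> B" for v
    using D0[of v] spectral_coord[OF B that, of g v] orthonormal_basis_inner[OF B that that]
    by (simp add: D)
  then have "?D *v x = 0" for x unfolding D spectral_mult_vector by simp
  then have "?D = 0" by (simp add: matrix_eq)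
  then have "matrix_inv S = matrix_inv T" by simp
  then show "S = T"
    by (metis pos_def_matrix_inv(1,2) S T matrix_mul_assoc matrix_mul_lid matrix_mul_rid)
qed

section \<open>Change of volume under positive definite maps\<close>

lemma nn_integral_lborel_shift:
  fixes f :: "'a::euclidean_space \<Rightarrow> ennreal"
  assumes [measurable]: "f \<in> borel_measurable borel"
  shows "(\<integral>\<^sup>+x. f (x + a) \<partial>lborel) = (\<integral>\<^sup>+x. f x \<partial>lborel)"
  by (subst lborel_distr_plus[of a, symmetric]) (simp add: nn_integral_distr add.commute)

lemma measurable_matrix_vector [measurable (raw)]:
  fixes R :: "real^'n^'n"
  assumes "f \<in> borel_measurable M"
  shows "(\<lambda>x. R *v f x) \<in> borel_measurable M"
proof -
  have "(*v) R \<in> borel_measurable borel"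
    by (intro borel_measurable_continuous_onI linear_continuous_on matrix_vector_mul_bounded_linear)
  from measurable_compose[OF assms this] show ?thesis .
qed

text \<open>Uniqueness of Haar measure, for the translation invariant measure
  \<open>A \<mapsto> emeasure lborel ((*v) R -` A)\<close>.  In the double integral of \<open>indicator C x * indicator A (R y)\<close>
  the substitutions \<open>y \<mapsto> y + Q x\<close>, then \<open>x \<mapsto> x - R y\<close>, then \<open>y \<mapsto> y + Q x\<close>, with the order of
  integration exchanged in between, interchange the roles of \<open>A\<close> and \<open>C\<close>, up to
  a reflection of \<open>C\<close>.  So preimages scale volume by a factor that can be read off from a single set \<open>C\<close>.\<close>

lemma emeasure_lborel_linear_preimage_mult:
  fixes R Q :: "real^'n^'n"
  assumes RQ: "R ** Q = mat 1" and [measurable]: "A \<in> sets borel" "C \<in> sets borel"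
  shows "emeasure lborel C * emeasure lborel ((*v) R -` A)
       = emeasure lborel A * emeasure lborel ((*v) R -` (uminus -` C))"
proof -
  define f g :: "real^'n \<Rightarrow> ennreal" where "f = indicator C" and "g = indicator A"
  have [measurable]: "f \<in> borel_measurable borel" "g \<in> borel_measurable borel"
    by (simp_all add: f_def g_def)
  have R: "R *v (y + Q *v x) = R *v y + x" for x y
    by (simp add: matrix_vector_right_distrib matrix_vector_mul_assoc RQ)
  have A: "(*v) R -` A \<in> sets lborel" and C: "(*v) R -` (uminus -` C) \<in> sets lborel"
    using measurable_sets[of "(*v) R" borel borel A] measurable_sets[of "\<lambda>y. - (R *v y)" borel borel C]
    by (auto simp: vimage_def)
  have "emeasure lborel C * emeasure lborel ((*v) R -` A)
    = (\<integral>\<^sup>+x. f x \<partial>lborel) * (\<integral>\<^sup>+y. g (R *v y) \<partial>lborel)"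
    using A by (simp add: f_def g_def nn_integral_indicator[symmetric] indicator_vimage del: nn_integral_indicator)
  also have "\<dots> = (\<integral>\<^sup>+x. \<integral>\<^sup>+y. f x * g (R *v y) \<partial>lborel \<partial>lborel)"
    by (simp add: nn_integral_cmult nn_integral_multc)
  also have "\<dots> = (\<integral>\<^sup>+x. \<integral>\<^sup>+y. f x * g (R *v y + x) \<partial>lborel \<partial>lborel)"
  proof (rule nn_integral_cong)
    fix x show "(\<integral>\<^sup>+y. f x * g (R *v y) \<partial>lborel) = (\<integral>\<^sup>+y. f x * g (R *v y + x) \<partial>lborel)"
      using nn_integral_lborel_shift[of "\<lambda>y. f x * g (R *v y)" "Q *v x"] by (simp add: R)
  qed
  also have "\<dots> = (\<integral>\<^sup>+y. \<integral>\<^sup>+x. f x * g (R *v y + x) \<partial>lborel \<partial>lborel)"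
    by (rule lborel_pair.Fubini'[symmetric]) simp
  also have "\<dots> = (\<integral>\<^sup>+y. \<integral>\<^sup>+x. f (x - R *v y) * g x \<partial>lborel \<partial>lborel)"
  proof (rule nn_integral_cong)
    fix y show "(\<integral>\<^sup>+x. f x * g (R *v y + x) \<partial>lborel) = (\<integral>\<^sup>+x. f (x - R *v y) * g x \<partial>lborel)"
      using nn_integral_lborel_shift[of "\<lambda>x. f x * g (R *v y + x)" "- (R *v y)"] by simp
  qed
  also have "\<dots> = (\<integral>\<^sup>+x. \<integral>\<^sup>+y. f (x - R *v y) * g x \<partial>lborel \<partial>lborel)"
    by (rule lborel_pair.Fubini') simp
  also have "\<dots> = (\<integral>\<^sup>+x. \<integral>\<^sup>+y. f (- (R *v y)) * g x \<partial>lborel \<partial>lborel)"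
  proof (rule nn_integral_cong)
    fix x show "(\<integral>\<^sup>+y. f (x - R *v y) * g x \<partial>lborel) = (\<integral>\<^sup>+y. f (- (R *v y)) * g x \<partial>lborel)"
      using nn_integral_lborel_shift[of "\<lambda>y. f (x - R *v y) * g x" "Q *v x"] by (simp add: R)
  qed
  also have "\<dots> = (\<integral>\<^sup>+x. g x \<partial>lborel) * (\<integral>\<^sup>+y. f (- (R *v y)) \<partial>lborel)"
    by (simp add: nn_integral_cmult nn_integral_multc mult.commute)
  also have "\<dots> = emeasure lborel A * emeasure lborel ((*v) R -` (uminus -` C))"
    using C by (simp add: f_def g_def nn_integral_indicator[symmetric] indicator_vimage del: nn_integral_indicator)
  finally show ?thesis .
qed

definition scales_volume :: "real^'n^'n \<Rightarrow> bool" where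
  "scales_volume R \<longleftrightarrow>
     (\<forall>A\<in>sets borel. ennreal \<bar>det R\<bar> * emeasure lborel ((*v) R -` A) = emeasure lborel A)"

lemma scales_volume_mult:
  fixes R Q :: "real^'n^'n"
  assumes "scales_volume R" "scales_volume Q"
  shows "scales_volume (R ** Q)"
  unfolding scales_volume_def
proof
  fix A :: "(real^'n) set" assume A: "A \<in> sets borel"
  have RA: "(*v) R -` A \<in> sets borel"
    using measurable_sets[OF measurable_matrix_vector[OF measurable_ident, of R] A] by simp
  have "(*v) (R ** Q) -` A = (*v) Q -` ((*v) R -` A)"
    by (auto simp: matrix_vector_mul_assoc)
  moreover have "ennreal \<bar>det (R ** Q)\<bar> = ennreal \<bar>det R\<bar> * ennreal \<bar>det Q\<bar>"
    by (simp add: det_mul abs_mult ennreal_mult')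
  ultimately show "ennreal \<bar>det (R ** Q)\<bar> * emeasure lborel ((*v) (R ** Q) -` A) = emeasure lborel A"
    using assms A RA by (simp add: scales_volume_def mult.assoc)
qed

text \<open>The scaling factor is read off from the unit ball, which orthogonal maps preserve.\<close>

lemma scales_volume_orthogonal:
  fixes U :: "real^'n^'n"
  assumes U: "orthogonal_matrix U"
  shows "scales_volume U"
  unfolding scales_volume_def
proof
  fix A :: "(real^'n) set" assume A: "A \<in> sets borel"
  let ?C = "ball 0 1 :: (real^'n) set"
  have norm: "norm (U *v x) = norm x" for x
    using U by (simp add: orthogonal_transformation_norm orthogonal_transformation_matrix)
  have "(*v) U -` (uminus -` ?C) = ?C" by (auto simp: norm)
  then have "emeasure lborel ?C * emeasure lborel ((*v) U -` A) = emeasure lborel ?C * emeasure lborel A"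
    using emeasure_lborel_linear_preimage_mult[of U "transpose U" A ?C] U A
    by (simp add: orthogonal_matrix_def mult.commute)
  moreover have "emeasure lborel ?C \<noteq> 0"
    using open_not_negligible[of ?C] by (auto simp: negligible_iff_emeasure0 emeasure_completion)
  moreover have "emeasure lborel ?C \<noteq> \<infinity>"
    using emeasure_bounded_finite[of ?C] by auto
  ultimately have "emeasure lborel ((*v) U -` A) = emeasure lborel A"
    by (simp add: ennreal_mult_cancel_left)
  moreover have "\<bar>det U\<bar> = 1" using det_orthogonal_matrix[OF U] by auto
  ultimately show "ennreal \<bar>det U\<bar> * emeasure lborel ((*v) U -` A) = emeasure lborel A" by simp
qed

lemma diagonal_mult_vector:
  fixes d :: "'n::finite \<Rightarrow> real"
  shows "((\<chi> i j. if i = j then d i else 0) *v x) $ i = d i * x $ i"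
  by (simp add: matrix_vector_mult_def if_distrib if_distribR cong: if_cong)

lemma scales_volume_diagonal:
  fixes d :: "'n::finite \<Rightarrow> real"
  assumes "\<And>i. d i \<noteq> 0"
  shows "scales_volume (\<chi> i j. if i = j then d i else 0)" (is "scales_volume ?D")
  unfolding scales_volume_def
proof
  fix A :: "(real^'n) set" assume [measurable]: "A \<in> sets borel"
  define D :: "real^'n^'n" where "D = (\<chi> i j. if i = j then d i else 0)"
  define c where "c b = b \<bullet> (D *v b)" for b
  have Dc: "(D *v x) $ i = d i * x $ i" for x i
    unfolding D_def by (rule diagonal_mult_vector)
  have c: "c (axis i 1) = d i" for i by (simp add: c_def inner_axis' Dc)
  have inj: "inj (\<lambda>i::'n. axis i (1::real))" by (auto simp: inj_on_def axis_eq_axis)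
  have Basis: "(Basis :: (real^'n) set) = range (\<lambda>i. axis i 1)" by (auto simp: Basis_vec_def)
  have Dx: "D *v x = 0 + (\<Sum>j\<in>Basis. (c j * (x \<bullet> j)) *\<^sub>R j)" for x
    by (rule euclidean_eqI) (auto simp: inner_sum_left inner_Basis if_distrib Basis inner_axis c Dc
        sum.reindex[OF inj] axis_eq_axis cong: if_cong)
  have det: "\<bar>det D\<bar> = (\<Prod>j\<in>Basis. \<bar>c j\<bar>)"
    by (simp add: D_def det_diagonal Basis prod.reindex[OF inj] c abs_prod)
  have "lborel = density (distr lborel borel ((*v) D)) (\<lambda>_. \<Prod>j\<in>Basis. \<bar>c j\<bar>)"
    unfolding Dx[abs_def] using assms by (intro lborel_affine_euclidean) (auto simp: Basis c)
  then have "emeasure lborel A = emeasure (density (distr lborel borel ((*v) D)) (\<lambda>_. ennreal \<bar>det D\<bar>)) A"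
    unfolding det by simp
  also have "\<dots> = ennreal \<bar>det D\<bar> * emeasure lborel ((*v) D -` A)"
    by (simp add: emeasure_density nn_integral_cmult_indicator emeasure_distr)
  finally show "ennreal \<bar>det ?D\<bar> * emeasure lborel ((*v) ?D -` A) = emeasure lborel A"
    by (simp add: D_def)
qed

lemma spectral_orthogonal_diagonal:
  fixes B :: "(real^'n) set"
  assumes B: "orthonormal_basis B"
  obtains U f where "orthogonal_matrix U" "range f = B"
    "spectral B g = U ** (\<chi> i j. if i = j then g (f i) else 0) ** transpose U"
proof -
  have "card B = CARD('n)"
    using B orthonormal_set_independent[of B] dim_eq_card[of B UNIV] unfolding orthonormal_basis_def by simp
  then obtain f where f: "bij_betw f (UNIV :: 'n set) B"
    using finite_same_card_bij[of "UNIV :: 'n set" B] orthonormal_basis_finite[OF B] by auto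
  define U :: "real^'n^'n" where "U = (\<chi> i j. f j $ i)"
  let ?D = "(\<chi> i j. if i = j then g (f i) else 0) :: real^'n^'n"
  have fB: "f i \<in> B" for i using f by (auto simp: bij_betw_def)
  have col: "column i U = f i" for i by (simp add: U_def column_def)
  have "orthogonal_matrix U"
    unfolding orthogonal_matrix_orthonormal_columns col
    using B fB f by (metis UNIV_I bij_betw_def inj_on_def orthonormal_basis_def pairwise_def)
  have Uax: "U *v axis i 1 = f i" for i by (simp add: matrix_vector_mult_basis col)
  have Dax: "?D *v axis i 1 = g (f i) *\<^sub>R axis i 1" for i
    by (simp add: vec_eq_iff diagonal_mult_vector) (simp add: axis_def)
  have UU: "transpose U ** U = mat 1" using \<open>orthogonal_matrix U\<close> by (simp add: orthogonal_matrix_def)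
  have "U ** ?D ** transpose U = spectral B g"
  proof (rule spectral_eqI[OF B])
    fix v assume "v \<in> B"
    then obtain i where i: "v = f i" using f by (auto simp: bij_betw_def)
    have "(U ** ?D ** transpose U) *v v = U *v (?D *v ((transpose U ** U) *v axis i 1))"
      unfolding i Uax[symmetric] by (simp only: matrix_vector_mul_assoc matrix_mul_assoc)
    also have "\<dots> = g v *\<^sub>R v" unfolding UU by (simp add: Dax matrix_vector_mult_scaleR Uax i)
    finally show "(U ** ?D ** transpose U) *v v = g v *\<^sub>R v" .
  qed
  then show thesis using that[of U f] \<open>orthogonal_matrix U\<close> f by (auto simp: bij_betw_def)
qed

text \<open>Diagonalise as \<open>U D U\<^bsup>T\<^esup>\<close> and compose the orthogonal and diagonal cases.\<close>

lemma scales_volume_pos_def: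
  fixes R :: "real^'n^'n"
  assumes "pos_def R"
  shows "scales_volume R"
proof -
  obtain B g where B: "orthonormal_basis B" and R: "R = spectral B g"
    using spectral_theorem pos_def_symmetric[OF assms] by metis
  have g: "\<forall>v\<in>B. g v > 0" using assms pos_def_spectral_iff[OF B] R by simp
  obtain U f where U: "orthogonal_matrix U" and f: "range f = B"
    and eq: "spectral B g = U ** (\<chi> i j. if i = j then g (f i) else 0) ** transpose U"
    using spectral_orthogonal_diagonal[OF B] by blast
  have "g (f i) \<noteq> 0" for i using g f by (metis less_irrefl rangeI)
  then show ?thesis unfolding R eq
    using U by (intro scales_volume_mult scales_volume_orthogonal scales_volume_diagonal)
      (auto simp: orthogonal_matrix_transpose)
qed

lemma lborel_distr_affine:
  fixes R :: "real^'n^'n"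
  assumes R: "pos_def R"
  shows "distr lborel borel (\<lambda>x. R *v x + c) = density lborel (\<lambda>_. ennreal (1 / \<bar>det R\<bar>))"
proof (rule measure_eqI)
  fix A assume "A \<in> sets (distr lborel borel (\<lambda>x. R *v x + c))"
  then have A [measurable]: "A \<in> sets borel" by simp
  let ?A = "(\<lambda>x. x + c) -` A"
  have A' [measurable]: "?A \<in> sets borel" using measurable_sets[of "\<lambda>x. x + c" borel borel A] by simp
  have d: "\<bar>det R\<bar> > 0" using pos_def_det_pos[OF R] by simp
  have "ennreal (1 / \<bar>det R\<bar>) * emeasure lborel A = ennreal (1 / \<bar>det R\<bar>) * emeasure lborel ?A"
    using nn_integral_lborel_shift[of "indicator A" c] A'
    by (simp add: nn_integral_indicator[symmetric] indicator_vimage del: nn_integral_indicator)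
  also have "emeasure lborel ?A = ennreal \<bar>det R\<bar> * emeasure lborel ((*v) R -` ?A)"
    using scales_volume_pos_def[OF R] A' by (simp add: scales_volume_def)
  also have "ennreal (1 / \<bar>det R\<bar>) * (ennreal \<bar>det R\<bar> * emeasure lborel ((*v) R -` ?A))
    = emeasure lborel ((*v) R -` ?A)"
    using d by (simp add: mult.assoc[symmetric] ennreal_mult'[symmetric])
  also have "(*v) R -` ?A = (\<lambda>x. R *v x + c) -` A" by auto
  finally show "emeasure (distr lborel borel (\<lambda>x. R *v x + c)) A
    = emeasure (density lborel (\<lambda>_. ennreal (1 / \<bar>det R\<bar>))) A"
    by (simp add: emeasure_density nn_integral_cmult_indicator emeasure_distr)
qed simp

section \<open>Affine images and second moments of Gaussians\<close>

lemma distr_gaussian_affine: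
  fixes R S :: "real^'n^'n"
  assumes R: "pos_def R" and S: "pos_def S"
  shows "distr (gaussian m S) borel (\<lambda>x. R *v x + c) = gaussian (R *v m + c) (R ** S ** R)"
proof -
  let ?T = "\<lambda>x. R *v x + c" and ?m = "R *v m + c" and ?S = "R ** S ** R"
  let ?R = "matrix_inv R"
  define d where "d = \<bar>det R\<bar>"
  have d: "d > 0" using pos_def_det_pos[OF R] by (simp add: d_def)
  note inv = pos_def_matrix_inv[OF R] pos_def_matrix_inv[OF S]
  have I: "X ** ?R ** R = X" "X ** R ** ?R = X" "X ** matrix_inv S ** S = X"
    "X ** S ** matrix_inv S = X" for X :: "real^'n^'n"
    by (metis inv matrix_mul_assoc matrix_mul_rid)+
  have Sinv: "matrix_inv ?S = ?R ** matrix_inv S ** ?R"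
    by (rule matrix_inv_eqI) (simp_all add: matrix_mul_assoc I inv)
  have quad: "(?T x - ?m) \<bullet> (matrix_inv ?S *v (?T x - ?m)) = (x - m) \<bullet> (matrix_inv S *v (x - m))" for x
  proof -
    have T: "?T x - ?m = R *v (x - m)" by (simp add: matrix_vector_mult_diff_distrib)
    show ?thesis unfolding T Sinv
      by (simp add: symmetric_inner_swap[OF pos_def_symmetric[OF R], symmetric]
          matrix_vector_mul_assoc matrix_mul_assoc I inv)
  qed
  have norm: "sqrt ((2 * pi) ^ CARD('n) * det ?S) = d * sqrt ((2 * pi) ^ CARD('n) * det S)"
    by (simp add: det_mul real_sqrt_mult d_def mult_ac)
  have pdf: "gaussian_pdf m S x = d * gaussian_pdf ?m ?S (?T x)" for x
    using d unfolding gaussian_pdf_def quad norm by simp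
  have "distr (gaussian m S) borel ?T
    = distr (density lborel (\<lambda>x. ennreal (d * gaussian_pdf ?m ?S (?T x)))) borel ?T"
    by (simp add: gaussian_eq_density pdf)
  also have "\<dots> = density (distr lborel borel ?T) (\<lambda>y. ennreal (d * gaussian_pdf ?m ?S y))"
    by (subst density_distr) auto
  also have "\<dots> = density lborel (\<lambda>y. ennreal (1 / d) * ennreal (d * gaussian_pdf ?m ?S y))"
    unfolding lborel_distr_affine[OF R] d_def[symmetric]
    by (subst density_density_eq) auto
  also have "\<dots> = gaussian ?m ?S"
    unfolding gaussian_eq_density using d by (simp add: ennreal_mult'[symmetric])
  finally show ?thesis .
qed

lemma integrable_exp_neg_square:
  fixes a :: real
  assumes "a > 0"
  shows "integrable lborel (\<lambda>x. exp (- a * (x - p)\<^sup>2))"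
proof -
  let ?s = "sqrt (1 / (2 * a))"
  have "integrable lborel (\<lambda>x. sqrt (2 * pi * ?s\<^sup>2) * normal_density p ?s x)"
    using assms by (intro integrable_mult_right integrable_normal_density) simp
  moreover have "sqrt (2 * pi * ?s\<^sup>2) * normal_density p ?s x = exp (- a * (x - p)\<^sup>2)" for x
    using assms by (simp add: normal_density_def)
  ultimately show ?thesis by simp
qed

lemma integrable_exp_neg_norm_square:
  fixes m :: "'a::euclidean_space"
  assumes "a > 0"
  shows "integrable lborel (\<lambda>x. exp (- a * (norm (x - m))\<^sup>2))"
proof (rule integrableI_bounded)
  have sq: "exp (- a * (norm (x - m))\<^sup>2) = (\<Prod>b\<in>Basis. exp (- a * (x \<bullet> b - m \<bullet> b)\<^sup>2))" for x :: 'a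
    unfolding power2_norm_eq_inner euclidean_inner[of "x - m" "x - m"]
    by (simp add: exp_sum[symmetric] sum_negf sum_distrib_left inner_diff_left power2_eq_square)
  have "(\<integral>\<^sup>+x. ennreal (norm (exp (- a * (norm (x - m))\<^sup>2))) \<partial>lborel)
    = (\<integral>\<^sup>+x. (\<Prod>b\<in>Basis. ennreal (exp (- a * (x \<bullet> b - m \<bullet> b)\<^sup>2))) \<partial>(lborel :: 'a measure))"
    unfolding sq by (simp add: prod_ennreal abs_prod)
  also have "\<dots> = (\<Prod>b\<in>Basis. \<integral>\<^sup>+x. ennreal (exp (- a * (x - m \<bullet> b)\<^sup>2)) \<partial>lborel)"
    by (subst nn_integral_lborel_prod[where f = "\<lambda>b x. ennreal (exp (- a * (x - m \<bullet> b)\<^sup>2))"]) auto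
  also have "\<dots> = (\<Prod>b\<in>Basis. ennreal (\<integral>x. exp (- a * (x - m \<bullet> b)\<^sup>2) \<partial>lborel))"
    using integrable_exp_neg_square[OF assms] by (simp add: nn_integral_eq_integral)
  also have "\<dots> < \<infinity>" by (simp add: prod_ennreal)
  finally show "(\<integral>\<^sup>+x. ennreal (norm (exp (- a * (norm (x - m))\<^sup>2))) \<partial>lborel) < \<infinity>" .
qed simp

text \<open>The density decays at least like \<open>exp (- k \<bar>x - m\<bar>\<^sup>2 / 2)\<close>.  Half of this exponent is spent
  on dominating the square, and the other half leaves an integrable function.\<close>

lemma integrable_gaussian_affine_square:
  fixes S :: "real^'n^'n"
  assumes S: "pos_def S"
  shows "integrable (gaussian m S) (\<lambda>x. (a \<bullet> x + c)\<^sup>2)"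
proof -
  obtain k where k: "k > 0" "\<And>x. k * (norm x)\<^sup>2 \<le> x \<bullet> (matrix_inv S *v x)"
    using pos_def_coercive[OF pos_def_matrix_inv(3)[OF S]] by blast
  define Z where "Z = sqrt ((2 * pi) ^ CARD('n) * det S)"
  have Z: "Z > 0" using pos_def_det_pos[OF S] by (simp add: Z_def)
  define K where "K = 2 * (norm a)\<^sup>2 * (4 / k) + 2 * (a \<bullet> m + c)\<^sup>2"
  have K: "(a \<bullet> x + c)\<^sup>2 \<le> K * exp (k / 4 * (norm (x - m))\<^sup>2)" for x
  proof -
    define s where "s = (norm (x - m))\<^sup>2"
    have "s \<ge> 0" by (simp add: s_def)
    have "(a \<bullet> (x - m))\<^sup>2 \<le> (norm a * norm (x - m))\<^sup>2"
      using Cauchy_Schwarz_ineq2[of a "x - m"] by (metis abs_ge_zero power2_abs power_mono)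
    then have 1: "(a \<bullet> (x - m))\<^sup>2 \<le> (norm a)\<^sup>2 * s" by (simp add: s_def power_mult_distrib)
    have "(a \<bullet> x + c)\<^sup>2 = (a \<bullet> (x - m) + (a \<bullet> m + c))\<^sup>2" by (simp add: inner_diff_right)
    also have "\<dots> \<le> 2 * (a \<bullet> (x - m))\<^sup>2 + 2 * (a \<bullet> m + c)\<^sup>2"
      using sum_squares_bound[of "a \<bullet> (x - m)" "a \<bullet> m + c"]
      unfolding power2_sum[of "a \<bullet> (x - m)"] by linarith
    also have "\<dots> \<le> 2 * (norm a)\<^sup>2 * s + 2 * (a \<bullet> m + c)\<^sup>2" using 1 by simp
    also have "\<dots> = 2 * (norm a)\<^sup>2 * (4 / k) * (k / 4 * s) + 2 * (a \<bullet> m + c)\<^sup>2 * 1" using k by simp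
    also have "\<dots> \<le> 2 * (norm a)\<^sup>2 * (4 / k) * exp (k / 4 * s) + 2 * (a \<bullet> m + c)\<^sup>2 * exp (k / 4 * s)"
    proof -
      have "k / 4 * s \<ge> 0" using k \<open>s \<ge> 0\<close> by simp
      then have "k / 4 * s \<le> exp (k / 4 * s)" "1 \<le> exp (k / 4 * s)"
        using exp_ge_add_one_self[of "k / 4 * s"] by linarith+
      then show ?thesis using k(1) by (intro add_mono mult_left_mono) auto
    qed
    also have "\<dots> = K * exp (k / 4 * s)" by (simp add: K_def algebra_simps)
    finally show ?thesis by (simp add: s_def)
  qed
  have "integrable lborel (\<lambda>x. gaussian_pdf m S x *\<^sub>R (a \<bullet> x + c)\<^sup>2)"
  proof (rule Bochner_Integration.integrable_bound)
    show "integrable lborel (\<lambda>x. K / Z * exp (- (k / 4) * (norm (x - m))\<^sup>2))"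
      using k by (intro integrable_mult_right integrable_exp_neg_norm_square) simp
    show "AE x in lborel. norm (gaussian_pdf m S x *\<^sub>R (a \<bullet> x + c)\<^sup>2)
        \<le> norm (K / Z * exp (- (k / 4) * (norm (x - m))\<^sup>2))"
    proof (rule AE_I2)
      fix x
      have "gaussian_pdf m S x * (a \<bullet> x + c)\<^sup>2
        \<le> (exp (- (k / 2) * (norm (x - m))\<^sup>2) / Z) * (K * exp (k / 4 * (norm (x - m))\<^sup>2))"
      proof (rule mult_mono)
        show "gaussian_pdf m S x \<le> exp (- (k / 2) * (norm (x - m))\<^sup>2) / Z"
          unfolding gaussian_pdf_def Z_def[symmetric]
          using k(2)[of "x - m"] Z by (intro divide_right_mono) auto
      qed (use K[of x] Z in auto)
      also have "\<dots> = K / Z * exp (- (k / 4) * (norm (x - m))\<^sup>2)"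
        by (simp add: exp_add[symmetric] field_simps)
      finally show "norm (gaussian_pdf m S x *\<^sub>R (a \<bullet> x + c)\<^sup>2)
        \<le> norm (K / Z * exp (- (k / 4) * (norm (x - m))\<^sup>2))"
        using gaussian_pdf_pos[OF S, of m x] k(1) Z by (simp add: abs_mult K_def)
    qed
  qed simp
  then show ?thesis unfolding gaussian_eq_density
    using gaussian_pdf_pos[OF S, of m] by (subst integrable_density) (auto simp: less_imp_le)
qed

section \<open>Gradient flows of quadratic potentials\<close>

definition quadratic :: "real^'n^'n \<Rightarrow> real^'n \<Rightarrow> real^'n \<Rightarrow> real" where
  "quadratic A b x = (x \<bullet> (A *v x)) / 2 + b \<bullet> x"

lemma is_quadratic_iff: "is_quadratic f \<longleftrightarrow> (\<exists>A b. transpose A = A \<and> f = quadratic A b)"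
  by (simp add: is_quadratic_def quadratic_def[abs_def])

lemma GDERIV_quadratic:
  fixes A :: "real^'n^'n"
  assumes "transpose A = A"
  shows "GDERIV (quadratic A b) y :> A *v y + b"
proof -
  have "(quadratic A b has_derivative (\<lambda>h. (y \<bullet> (A *v h) + h \<bullet> (A *v y)) / 2 + b \<bullet> h)) (at y)"
    unfolding quadratic_def
    by (auto intro!: derivative_eq_intros bounded_linear.has_derivative[OF matrix_vector_mul_bounded_linear])
  moreover have "(\<lambda>h. (y \<bullet> (A *v h) + h \<bullet> (A *v y)) / 2 + b \<bullet> h) = (\<lambda>h. h \<bullet> (A *v y + b))"
    using symmetric_inner_swap[OF assms, of y] by (auto simp: inner_add_right inner_commute)
  ultimately show ?thesis by (simp add: gderiv_def)
qed

lemma GDERIV_unique: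
  assumes "GDERIV f x :> u" "GDERIV f x :> v"
  shows "u = v"
proof -
  have "(\<lambda>h. h \<bullet> u) = (\<lambda>h. h \<bullet> v)"
    using assms unfolding gderiv_def by (rule has_derivative_unique)
  then show ?thesis by (metis vector_eq_ldot)
qed

lemma is_gradient_flow_quadratic_iff:
  fixes A :: "real^'n^'n"
  assumes "transpose A = A"
  shows "is_gradient_flow (quadratic A b) \<phi> \<longleftrightarrow>
    (\<forall>x. \<phi> 0 x = x \<and> (\<forall>t. ((\<lambda>s. \<phi> s x) has_vector_derivative (A *v \<phi> t x + b)) (at t)))"
  unfolding is_gradient_flow_def
  using GDERIV_quadratic[OF assms] GDERIV_unique by metis

text \<open>The integral of \<open>exp (s * l)\<close> over \<open>s\<close> from \<open>0\<close> to \<open>t\<close>.\<close>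

definition exp_primitive :: "real \<Rightarrow> real \<Rightarrow> real" where
  "exp_primitive l t = (if l = 0 then t else (exp (t * l) - 1) / l)"

lemma exp_primitive_zero [simp]: "exp_primitive l 0 = 0"
  by (simp add: exp_primitive_def)

lemma exp_eq_exp_primitive: "exp (t * l) = 1 + l * exp_primitive l t"
  by (simp add: exp_primitive_def)

lemma exp_primitive_double: "exp_primitive (2 * l) t = exp_primitive l t + l * (exp_primitive l t)\<^sup>2 / 2"
proof (cases "l = 0")
  case False
  have "exp (t * (2 * l)) = (exp (t * l))\<^sup>2" by (simp add: exp_double[symmetric] mult_ac)
  then have "1 + 2 * l * exp_primitive (2 * l) t = (1 + l * exp_primitive l t)\<^sup>2"
    by (simp only: exp_eq_exp_primitive mult.assoc)
  then have "2 * l * exp_primitive (2 * l) t = 2 * l * (exp_primitive l t + l * (exp_primitive l t)\<^sup>2 / 2)"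
    by (simp add: power2_eq_square algebra_simps)
  then show ?thesis using False by simp
qed (simp add: exp_primitive_def)

lemma exp_primitive_deriv [derivative_intros]: "(exp_primitive l has_real_derivative exp (t * l)) (at t)"
  unfolding exp_primitive_def by (cases "l = 0") (auto intro!: derivative_eq_intros)

lemma exp_primitive_strict_mono: "s < t \<Longrightarrow> exp_primitive l s < exp_primitive l t"
  by (rule DERIV_pos_imp_increasing) (use exp_primitive_deriv exp_gt_zero in blast)+

lemma exp_primitive_pos: "t > 0 \<Longrightarrow> exp_primitive l t > 0"
  using exp_primitive_strict_mono[of 0 t l] by simp

lemma continuous_on_exp_primitive: "continuous_on S (exp_primitive l)"
  by (rule DERIV_continuous_on[OF has_field_derivative_at_within[OF exp_primitive_deriv]])

text \<open>The eigencoordinate \<open>y = v \<bullet> \<phi> t x\<close> solves \<open>y' = l v * y + v \<bullet> b\<close>, so its speed at time \<open>s\<close> is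
  \<open>exp (s * l v)\<close> times the initial speed \<open>l v * (v \<bullet> x) + v \<bullet> b\<close>.\<close>

definition affine_flow ::
    "(real^'n) set \<Rightarrow> (real^'n \<Rightarrow> real) \<Rightarrow> real^'n \<Rightarrow> real \<Rightarrow> real^'n \<Rightarrow> real^'n" where
  "affine_flow B l b t x = x + (\<Sum>v\<in>B. (exp_primitive (l v) t * (l v * (v \<bullet> x) + v \<bullet> b)) *\<^sub>R v)"

lemma affine_flow_coord:
  assumes "orthonormal_basis B" "v \<in> B"
  shows "v \<bullet> affine_flow B l b t x = v \<bullet> x + exp_primitive (l v) t * (l v * (v \<bullet> x) + v \<bullet> b)"
  using assms by (simp add: affine_flow_def inner_add_right orthonormal_basis_inner_sum)

lemma affine_flow_time_one:
  assumes B: "orthonormal_basis B"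
  shows "affine_flow B l b 1 x
    = spectral B (\<lambda>v. exp (l v)) *v x + spectral B (\<lambda>v. exp_primitive (l v) 1) *v b"
proof (rule orthonormal_basis_eqI[OF B])
  fix v assume "v \<in> B"
  then show "v \<bullet> affine_flow B l b 1 x
    = v \<bullet> (spectral B (\<lambda>v. exp (l v)) *v x + spectral B (\<lambda>v. exp_primitive (l v) 1) *v b)"
    using exp_eq_exp_primitive[of 1 "l v"] B
    by (simp add: affine_flow_coord inner_add_right spectral_coord algebra_simps)
qed

lemma affine_flow_derivative:
  assumes B: "orthonormal_basis B"
  shows "((\<lambda>s. affine_flow B l b s x) has_vector_derivative
    (spectral B l *v affine_flow B l b t x + b)) (at t)"
proof -
  have "((\<lambda>s. affine_flow B l b s x) has_vector_derivative
      (\<Sum>v\<in>B. (exp (t * l v) * (l v * (v \<bullet> x) + v \<bullet> b)) *\<^sub>R v)) (at t)"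
    unfolding affine_flow_def
    by (auto intro!: derivative_eq_intros exp_primitive_deriv simp: has_real_derivative_iff_has_vector_derivative[symmetric])
  also have "(\<Sum>v\<in>B. (exp (t * l v) * (l v * (v \<bullet> x) + v \<bullet> b)) *\<^sub>R v)
      = spectral B l *v affine_flow B l b t x + b"
    by (rule orthonormal_basis_eqI[OF B])
      (simp only: B orthonormal_basis_inner_sum spectral_coord inner_add_right affine_flow_coord
        exp_eq_exp_primitive, simp add: algebra_simps)
  finally show ?thesis .
qed

lemma is_gradient_flow_affine_flow:
  assumes "orthonormal_basis B"
  shows "is_gradient_flow (quadratic (spectral B l) b) (affine_flow B l b)"
  using assms affine_flow_derivative[OF assms]
  by (simp add: is_gradient_flow_quadratic_iff spectral_symmetric) (simp add: affine_flow_def)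

lemma linear_ode_zero:
  fixes z :: "real \<Rightarrow> real"
  assumes z: "\<And>t. (z has_real_derivative l * z t) (at t)" and z0: "z 0 = 0"
  shows "z t = 0"
proof -
  have "((\<lambda>t. exp (- l * t) * z t) has_real_derivative 0) (at t)" for t
    by (rule derivative_eq_intros z refl | simp)+
  then have "exp (- l * t) * z t = exp (- l * 0) * z 0"
    using DERIV_isconst_all[of "\<lambda>t. exp (- l * t) * z t"] by blast
  then show ?thesis using z0 by simp
qed

text \<open>The difference of two solutions has eigencoordinates solving \<open>z' = l v * z\<close>, \<open>z 0 = 0\<close>.\<close>

lemma gradient_flow_unique:
  fixes B :: "(real^'n) set"
  assumes B: "orthonormal_basis B" and flow: "is_gradient_flow (quadratic (spectral B l) b) \<phi>"
  shows "\<phi> = affine_flow B l b"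
proof (intro ext)
  fix t x
  define z where "z t = \<phi> t x - affine_flow B l b t x" for t
  have \<phi>: "\<phi> 0 x = x" "\<And>t. ((\<lambda>s. \<phi> s x) has_vector_derivative (spectral B l *v \<phi> t x + b)) (at t)"
    using flow by (auto simp: is_gradient_flow_quadratic_iff spectral_symmetric B)
  have z': "(z has_vector_derivative (spectral B l *v z t)) (at t)" for t
    unfolding z_def
    by (rule has_vector_derivative_eq_rhs[OF has_vector_derivative_diff[OF \<phi>(2) affine_flow_derivative[OF B]]])
       (simp add: matrix_vector_mult_diff_distrib)
  have "v \<bullet> z t = 0" if v: "v \<in> B" for v
  proof (rule linear_ode_zero[where z = "\<lambda>t. v \<bullet> z t" and l = "l v"])
    fix t
    have "((\<lambda>t. v \<bullet> z t) has_vector_derivative (v \<bullet> (spectral B l *v z t))) (at t)"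
      by (rule bounded_linear.has_vector_derivative[OF bounded_linear_inner_right z'])
    then show "((\<lambda>t. v \<bullet> z t) has_real_derivative l v * (v \<bullet> z t)) (at t)"
      by (simp add: has_real_derivative_iff_has_vector_derivative spectral_coord[OF B v])
  next
    show "v \<bullet> z 0 = 0" by (simp add: z_def \<phi>(1) affine_flow_def)
  qed
  then have "z t = 0" by (intro orthonormal_basis_eqI[OF B]) simp
  then show "\<phi> t x = affine_flow B l b t x" by (simp add: z_def)
qed

lemma gradient_flow_eq_affine_flow:
  assumes "orthonormal_basis B"
  shows "gradient_flow (quadratic (spectral B l) b) = affine_flow B l b"
  unfolding gradient_flow_def
  using is_gradient_flow_affine_flow[OF assms] gradient_flow_unique[OF assms] by (rule the_equality)

section \<open>The potential transporting one Gaussian to another\<close>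

text \<open>The predicate inside the definite description that defines \<^const>\<open>wkl_potential\<close>.\<close>

definition potential_transports ::
    "(real^'n \<Rightarrow> real) \<Rightarrow> (real^'n) measure \<Rightarrow> (real^'n) measure \<Rightarrow> bool" where
  "potential_transports f \<mu> \<nu> \<longleftrightarrow> is_quadratic f \<and>
     (\<exists>\<phi>. is_gradient_flow f \<phi> \<and> \<phi> 1 \<in> borel_measurable \<mu> \<and> distr \<mu> borel (\<phi> 1) = \<nu>)"

lemma wkl_potential_eq: "wkl_potential \<mu> \<nu> = (THE f. potential_transports f \<mu> \<nu>)"
  by (simp add: wkl_potential_def potential_transports_def)

lemma distr_affine_flow:
  fixes B :: "(real^'n) set"
  assumes B: "orthonormal_basis B" and S: "pos_def S"
  shows "distr (gaussian m S) borel (affine_flow B l b 1) =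
    gaussian (spectral B (\<lambda>v. exp (l v)) *v m + spectral B (\<lambda>v. exp_primitive (l v) 1) *v b)
      (spectral B (\<lambda>v. exp (l v)) ** S ** spectral B (\<lambda>v. exp (l v)))"
proof -
  have "pos_def (spectral B (\<lambda>v. exp (l v)))" by (simp add: pos_def_spectral_iff[OF B])
  from distr_gaussian_affine[OF this S] show ?thesis
    by (simp add: affine_flow_time_one[OF B, abs_def])
qed

lemma affine_flow_measurable:
  fixes B :: "(real^'n) set"
  assumes B: "orthonormal_basis B"
  shows "affine_flow B l b t \<in> borel_measurable borel"
  unfolding affine_flow_def by simp

lemma potential_transports_iff:
  fixes B :: "(real^'n) set"
  assumes B: "orthonormal_basis B" and S: "pos_def S"
  shows "potential_transports (quadratic (spectral B l) b) (gaussian m S) \<nu> \<longleftrightarrow>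
    distr (gaussian m S) borel (affine_flow B l b 1) = \<nu>"
proof -
  have "is_quadratic (quadratic (spectral B l) b)"
    unfolding is_quadratic_iff using spectral_symmetric[OF B] by blast
  moreover have "is_gradient_flow (quadratic (spectral B l) b) \<phi> \<longleftrightarrow> \<phi> = affine_flow B l b" for \<phi>
    using is_gradient_flow_affine_flow[OF B] gradient_flow_unique[OF B] by blast
  moreover have "affine_flow B l b 1 \<in> borel_measurable (gaussian m S)"
    using affine_flow_measurable[OF B] by simp
  ultimately show ?thesis by (simp add: potential_transports_def)
qed

lemma is_quadratic_spectral:
  fixes f :: "real^'n \<Rightarrow> real"
  assumes "is_quadratic f"
  obtains B l b where "orthonormal_basis B" "f = quadratic (spectral B l) b"
  using assms spectral_theorem unfolding is_quadratic_iff by metis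

lemma potential_transports_exists:
  fixes S0 S1 :: "real^'n^'n"
  assumes S0: "pos_def S0" and S1: "pos_def S1"
  shows "\<exists>f. potential_transports f (gaussian m0 S0) (gaussian m1 S1)"
proof -
  obtain R where R: "pos_def R" "R ** S0 ** R = S1" using riccati_exists[OF S0 S1] .
  obtain B r where B: "orthonormal_basis B" and r: "R = spectral B r"
    using spectral_theorem pos_def_symmetric[OF R(1)] by metis
  define l where "l v = ln (r v)" for v
  define b where "b = spectral B (\<lambda>v. 1 / exp_primitive (l v) 1) *v (m1 - R *v m0)"
  have "r v > 0" if "v \<in> B" for v using that R(1) pos_def_spectral_iff[OF B] r by simp
  then have expl: "spectral B (\<lambda>v. exp (l v)) = R" unfolding r by (intro spectral_cong) (simp add: l_def)
  have "exp_primitive a 1 \<noteq> 0" for a using exp_primitive_pos[of 1 a] by simp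
  then have "spectral B (\<lambda>v. exp_primitive (l v) 1) *v b = m1 - R *v m0"
    unfolding b_def by (simp add: matrix_vector_mul_assoc spectral_mult[OF B] spectral_one[OF B])
  then have "distr (gaussian m0 S0) borel (affine_flow B l b 1) = gaussian m1 S1"
    unfolding distr_affine_flow[OF B S0] expl R(2) by simp
  then show ?thesis using potential_transports_iff[OF B S0] by blast
qed

text \<open>Equality of the image measures forces equal covariances, hence equal exponentials
  \<open>R = Q\<close> by \<open>riccati_unique\<close>, hence equal logarithms \<open>A\<close>; equality of the means then gives equal
  \<open>b\<close>, since the integrated exponential applied to \<open>b\<close> has positive eigenvalues.\<close>

lemma potential_transports_unique:
  fixes S0 S1 :: "real^'n^'n"
  assumes S0: "pos_def S0" and S1: "pos_def S1"
    and f: "potential_transports f (gaussian m0 S0) (gaussian m1 S1)"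
    and g: "potential_transports g (gaussian m0 S0) (gaussian m1 S1)"
  shows "f = g"
proof -
  obtain B l b where B: "orthonormal_basis B" and f': "f = quadratic (spectral B l) b"
    using f is_quadratic_spectral unfolding potential_transports_def by metis
  obtain C k c where C: "orthonormal_basis C" and g': "g = quadratic (spectral C k) c"
    using g is_quadratic_spectral unfolding potential_transports_def by metis
  define R Q where "R = spectral B (\<lambda>v. exp (l v))" and "Q = spectral C (\<lambda>v. exp (k v))"
  define u w where "u = spectral B (\<lambda>v. exp_primitive (l v) 1) *v b" and "w = spectral C (\<lambda>v. exp_primitive (k v) 1) *v c"
  have pd: "pos_def R" "pos_def Q" by (simp_all add: R_def Q_def pos_def_spectral_iff B C)
  have F: "gaussian (R *v m0 + u) (R ** S0 ** R) = gaussian m1 S1"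
    using f unfolding f' potential_transports_iff[OF B S0] distr_affine_flow[OF B S0] R_def u_def .
  have G: "gaussian (Q *v m0 + w) (Q ** S0 ** Q) = gaussian m1 S1"
    using g unfolding g' potential_transports_iff[OF C S0] distr_affine_flow[OF C S0] Q_def w_def .
  have RS: "pos_def (R ** S0 ** R)" "pos_def (Q ** S0 ** Q)"
    using pd S0 pos_def_congruence pos_def_symmetric pos_def_kernel by blast+
  have "R = Q"
    using gaussian_inj(2)[OF RS(1) S1 F] gaussian_inj(2)[OF RS(2) S1 G] riccati_unique[OF S0 pd] by simp
  then have AA: "spectral B l = spectral C k"
    unfolding R_def Q_def by (rule spectral_transfer[OF B C]) simp
  have uw: "u = w"
    using gaussian_inj(1)[OF RS(1) S1 F] gaussian_inj(1)[OF RS(2) S1 G] \<open>R = Q\<close>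
    by (metis add_left_cancel)
  have KK: "spectral B (\<lambda>v. exp_primitive (l v) 1) = spectral C (\<lambda>v. exp_primitive (k v) 1)"
    using AA by (rule spectral_transfer[OF B C]) simp
  have "b = c"
  proof (rule orthonormal_basis_eqI[OF B])
    fix v assume v: "v \<in> B"
    have "v \<bullet> (spectral B (\<lambda>v. exp_primitive (l v) 1) *v b) = v \<bullet> (spectral B (\<lambda>v. exp_primitive (l v) 1) *v c)"
      using uw unfolding u_def w_def KK by simp
    then show "v \<bullet> b = v \<bullet> c" using exp_primitive_pos[of 1 "l v"] by (simp add: spectral_coord[OF B v])
  qed
  then show ?thesis by (simp add: f' g' AA)
qed

lemma wkl_potential_eqI:
  fixes S0 S1 :: "real^'n^'n"
  assumes "pos_def S0" "pos_def S1" "potential_transports f (gaussian m0 S0) (gaussian m1 S1)"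
  shows "wkl_potential (gaussian m0 S0) (gaussian m1 S1) = f"
  unfolding wkl_potential_eq
  by (rule the_equality[where P = "\<lambda>f. potential_transports f _ _", OF assms(3)])
     (rule potential_transports_unique[OF assms(1,2) _ assms(3)])

section \<open>The divergence as a weighted sum of squares\<close>

lemma quadratic_spectral:
  assumes B: "orthonormal_basis B"
  shows "quadratic (spectral B l) b y = (\<Sum>v\<in>B. l v * (v \<bullet> y)\<^sup>2 / 2 + (v \<bullet> b) * (v \<bullet> y))"
  by (simp add: quadratic_def spectral_inner[OF B] orthonormal_basis_parseval[OF B, of b y]
      sum.distrib sum_divide_distrib power2_eq_square mult.assoc)

text \<open>Integrated form of \<open>(d/dt) f (\<phi>\<^sub>t x) = \<bar>\<nabla>f (\<phi>\<^sub>t x)\<bar>\<^sup>2\<close>: the gradient at time \<open>t\<close> has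
  \<open>v\<close>-coordinate \<open>exp (t * l v) * (l v * (v \<bullet> x) + v \<bullet> b)\<close>, and the squared exponentials
  \<open>exp (t * (2 * l v))\<close> integrate to the factor with doubled eigenvalue.\<close>

lemma quadratic_along_flow:
  assumes B: "orthonormal_basis B"
  shows "quadratic (spectral B l) b (affine_flow B l b t x) = quadratic (spectral B l) b x
    + (\<Sum>v\<in>B. exp_primitive (2 * l v) t * (l v * (v \<bullet> x) + v \<bullet> b)\<^sup>2)"
  unfolding quadratic_spectral[OF B] sum.distrib[symmetric]
proof (rule sum.cong[OF refl])
  fix v assume v: "v \<in> B"
  show "l v * (v \<bullet> affine_flow B l b t x)\<^sup>2 / 2 + (v \<bullet> b) * (v \<bullet> affine_flow B l b t x)
    = l v * (v \<bullet> x)\<^sup>2 / 2 + (v \<bullet> b) * (v \<bullet> x) + exp_primitive (2 * l v) t * (l v * (v \<bullet> x) + v \<bullet> b)\<^sup>2"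
    unfolding affine_flow_coord[OF B v] exp_primitive_double
    by (simp add: field_simps power2_eq_square)
qed

definition flow_weight :: "real \<Rightarrow> real" where
  "flow_weight l = (LINT t:{0..1}|lborel. exp_primitive (2 * l) 1 - exp_primitive (2 * l) t)"

lemma flow_weight_integrable:
  "set_integrable lborel {0..1} (\<lambda>t. exp_primitive (2 * l) 1 - exp_primitive (2 * l) t)"
  by (intro borel_integrable_atLeastAtMost' continuous_intros continuous_on_exp_primitive)

text \<open>The integrand is decreasing in \<open>t\<close> and reaches zero only at \<open>t = 1\<close>, so its value at \<open>1 / 2\<close>
  bounds it from below on the first half of the interval.\<close>

lemma flow_weight_pos: "flow_weight l > 0"
proof -
  define g where "g t = exp_primitive (2 * l) 1 - exp_primitive (2 * l) t" for t
  have mono: "g t \<le> g s" if "s \<le> t" for s t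
    using exp_primitive_strict_mono[of s t "2 * l"] that by (cases "s = t") (auto simp: g_def)
  have "0 < g (1 / 2) * (1 / 2)" using exp_primitive_strict_mono[of "1/2" 1 "2 * l"] by (simp add: g_def)
  also have "\<dots> = (LINT t|lborel. indicator {0..1 / 2 :: real} t *\<^sub>R g (1 / 2))" by simp
  also have "\<dots> \<le> (LINT t|lborel. indicator {0..1} t *\<^sub>R g t)"
  proof (rule integral_mono)
    show "integrable lborel (\<lambda>t. indicator {0..1 / 2 :: real} t *\<^sub>R g (1 / 2))"
      using emeasure_bounded_finite[of "{0..1 / 2 :: real}"]
      by (intro integrable_scaleR_left integrable_real_indicator) auto
    show "integrable lborel (\<lambda>t. indicator {0..1} t *\<^sub>R g t)"
      using flow_weight_integrable[of l] by (simp add: set_integrable_def g_def)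
    show "indicator {0..1 / 2} t *\<^sub>R g (1 / 2) \<le> indicator {0..1} t *\<^sub>R g t" for t
      using mono[of t "1 / 2"] mono[of t 1] by (auto simp: indicator_def g_def)
  qed
  finally show ?thesis by (simp add: flow_weight_def set_lebesgue_integral_def g_def)
qed

lemma potential_gain_along_flow:
  assumes B: "orthonormal_basis B"
  shows "(LINT t:{0..1}|lborel. quadratic (spectral B l) b (affine_flow B l b 1 x)
      - quadratic (spectral B l) b (affine_flow B l b t x))
    = (\<Sum>v\<in>B. flow_weight (l v) * (l v * (v \<bullet> x) + v \<bullet> b)\<^sup>2)"
proof -
  let ?g = "\<lambda>v t. (exp_primitive (2 * l v) 1 - exp_primitive (2 * l v) t)"
  have "quadratic (spectral B l) b (affine_flow B l b 1 x) - quadratic (spectral B l) b (affine_flow B l b t x)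
    = (\<Sum>v\<in>B. ?g v t * (l v * (v \<bullet> x) + v \<bullet> b)\<^sup>2)" for t
    unfolding quadratic_along_flow[OF B] by (simp add: sum_subtractf[symmetric] left_diff_distrib)
  moreover have "(LINT t:{0..1}|lborel. (\<Sum>v\<in>B. ?g v t * (l v * (v \<bullet> x) + v \<bullet> b)\<^sup>2))
    = (\<Sum>v\<in>B. LINT t:{0..1}|lborel. ?g v t * (l v * (v \<bullet> x) + v \<bullet> b)\<^sup>2)"
    unfolding set_lebesgue_integral_def scaleR_sum_right
    using flow_weight_integrable
    by (intro Bochner_Integration.integral_sum) (simp add: set_integrable_def mult.assoc[symmetric])
  ultimately show ?thesis by (simp add: flow_weight_def)
qed

section \<open>Positivity of the divergence\<close>

theorem mainTheorem5:
  fixes \<mu> \<nu> :: "(real^'n) measure"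
    and m0 m1 :: "real^'n"
    and S0 S1 :: "real^'n^'n"
  assumes "pos_def S0" and "pos_def S1"
    and "\<mu> = gaussian m0 S0" and "\<nu> = gaussian m1 S1"
  shows "wkl_divergence \<mu> \<nu> \<ge> 0 \<and> (wkl_divergence \<mu> \<nu> = 0 \<longleftrightarrow> \<mu> = \<nu>)"
proof -
  obtain f where f: "potential_transports f \<mu> \<nu>"
    using potential_transports_exists assms by metis
  then obtain B l b where B: "orthonormal_basis B" and f': "f = quadratic (spectral B l) b"
    using is_quadratic_spectral unfolding potential_transports_def by metis
  have pot: "wkl_potential \<mu> \<nu> = f"
    using f assms wkl_potential_eqI by metis
  have push: "distr \<mu> borel (affine_flow B l b 1) = \<nu>"
    using f potential_transports_iff[OF B \<open>pos_def S0\<close>] by (simp add: f' assms)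
  define h where "h x = (\<Sum>v\<in>B. flow_weight (l v) * (l v * (v \<bullet> x) + v \<bullet> b)\<^sup>2)" for x
  have div: "wkl_divergence \<mu> \<nu> = (LINT x|\<mu>. h x)"
    unfolding wkl_divergence_def pot f' gradient_flow_eq_affine_flow[OF B] Let_def
      potential_gain_along_flow[OF B] h_def ..
  have hnn: "0 \<le> h x" for x
    unfolding h_def using flow_weight_pos by (intro sum_nonneg) (simp add: less_imp_le)
  have hint: "integrable \<mu> h"
    unfolding h_def assms(3)
    using integrable_gaussian_affine_square[OF \<open>pos_def S0\<close>, of m0 "l _ *\<^sub>R _"]
    by (intro Bochner_Integration.integrable_sum integrable_mult_right) simp
  have "\<mu> = \<nu>" if "wkl_divergence \<mu> \<nu> = 0"
  proof -
    have "AE x in \<mu>. h x = 0"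
      using that integral_nonneg_eq_0_iff_AE[OF hint] hnn by (simp add: div)
    moreover have "affine_flow B l b 1 x = x" if "h x = 0" for x
    proof -
      have "l v * (v \<bullet> x) + v \<bullet> b = 0" if "v \<in> B" for v
        using \<open>h x = 0\<close> that orthonormal_basis_finite[OF B] flow_weight_pos
        by (subst (asm) h_def, subst (asm) sum_nonneg_eq_0_iff)
           (auto simp: less_imp_le less_imp_neq[THEN not_sym])
      then show ?thesis by (simp add: affine_flow_def)
    qed
    ultimately have "AE x in \<mu>. affine_flow B l b 1 x = x" by auto
    then have "distr \<mu> borel (affine_flow B l b 1) = distr \<mu> borel (\<lambda>x. x)"
      using affine_flow_measurable[OF B] by (intro distr_cong_AE) (simp_all add: assms(3))
    then show ?thesis using push by (simp add: distr_id2 assms(3))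
  qed
  moreover have "wkl_divergence \<mu> \<nu> = 0" if "\<mu> = \<nu>"
  proof -
    have "potential_transports (quadratic 0 0) \<mu> \<nu>"
    proof -
      have "is_gradient_flow (quadratic 0 (0 :: real^'n)) (\<lambda>t x. x)"
        by (subst is_gradient_flow_quadratic_iff) (auto simp: transpose_def vec_eq_iff)
      moreover have "is_quadratic (quadratic 0 (0 :: real^'n))"
        unfolding is_quadratic_iff by (intro exI[of _ 0]) (simp add: transpose_def vec_eq_iff)
      moreover have "(\<lambda>x. x) \<in> borel_measurable \<mu>" "distr \<mu> borel (\<lambda>x. x) = \<mu>"
        by (simp_all add: assms(3) distr_id2)
      ultimately show ?thesis unfolding potential_transports_def using that by blast
    qed
    then have "wkl_potential \<mu> \<nu> = quadratic 0 0"
      using assms wkl_potential_eqI by metis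
    then show ?thesis by (simp add: wkl_divergence_def quadratic_def)
  qed
  moreover have "wkl_divergence \<mu> \<nu> \<ge> 0" unfolding div using hnn by simp
  ultimately show ?thesis by blast
qed

end
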